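(* The dual of the Bricard property is its converse: for every projective plane $\Pi$, the dual of the Bricard property holds in $\Pi$ if and only if the converse Bricard property holds in $\Pi$.
   Context: A projective plane is an incidence structure of points and lines such that: (P1) any two distinct points $A,B$ are incident with a unique line, denoted $AB$; (P2) any two distinct lines $m,n$ are incident with a unique common point, denoted $m\cap n$; (P3) there are four points no three of which are collinear. Points are collinear if they are all incident with a common line; lines are concurrent if they are all incident with a common point. A triangle is an ordered triple of noncollinear points (its vertices); its sides are the lines joining pairs of vertices. The following are properties that a projective plane may or may not have. The Bricard property: Let $ABC$ and $A'B'C'$ be two triangles, and let $P:=BC\cap B'C'$, $Q:=AC\cap A'C'$, $R:=AB\cap A'B'$. If $A'P$, $B'Q$ and $C'R$ are concurrent, then $D:=BC\cap AA'$, $E:=AC\cap BB'$ and $F:=AB\cap CC'$ are collinear. The converse Bricard property: Let $ABC$ and $A'B'C'$ be two triangles, and let $P:=BC\cap B'C'$, $Q:=AC\cap A'C'$, $R:=AB\cap A'B'$. If $D:=BC\cap AA'$, $E:=AC\cap BB'$ and $F:=AB\cap CC'$ are collinear, then $A'P$, $B'Q$ and $C'R$ are concurrent. In both properties the triangles are assumed to be such that all the points and lines named are well defined, i.e. $A\neq A'$, $B\neq B'$, $C\neq C'$, $BC\neq B'C'$, $AC\neq A'C'$, $AB\neq A'B'$. The dual of a property is the statement obtained by interchanging the roles of points and lines (joining with intersecting, collinear with concurrent). So the dual of the Bricard property holds in $\Pi$ if and only if the Bricard property holds in the dual plane of $\Pi$ (whose points are the lines of $\Pi$ and whose lines are the points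 of $\Pi$, with the same incidence). Explicitly, the dual of the Bricard property reads: Let $a,b,c$ and $a',b',c'$ be the sides of two triangles (i.e. two ordered triples of nonconcurrent lines). Let $p$ be the line through $b\cap c$ and $b'\cap c'$, let $q$ be the line through $a\cap c$ and $a'\cap c'$, and let $r$ be the line through $a\cap b$ and $a'\cap b'$. If $a'\cap p$, $b'\cap q$ and $c'\cap r$ are collinear, then the line $d$ through $b\cap c$ and $a\cap a'$, the line $e$ through $a\cap c$ and $b\cap b'$, and the line $f$ through $a\cap b$ and $c\cap c'$ are concurrent. (Again all named points and lines are assumed well defined, i.e. $a\neq a'$, $b\neq b'$, $c\neq c'$, $b\cap c\neq b'\cap c'$, $a\cap c\neq a'\cap c'$, $a\cap b\neq a'\cap b'$.) *)

theory Defs imports Main begin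

text \<open>
  An incidence structure is given by its incidence relation \<open>I :: 'p \<Rightarrow> 'l \<Rightarrow> bool\<close>;
  the types \<open>'p\<close> and \<open>'l\<close> are its sets of points and of lines.
\<close>

definition collinear :: "('p \<Rightarrow> 'l \<Rightarrow> bool) \<Rightarrow> 'p set \<Rightarrow> bool" where
  "collinear I S \<longleftrightarrow> (\<exists>l. \<forall>A\<in>S. I A l)"

definition concurrent :: "('p \<Rightarrow> 'l \<Rightarrow> bool) \<Rightarrow> 'l set \<Rightarrow> bool" where
  "concurrent I S \<longleftrightarrow> (\<exists>A. \<forall>l\<in>S. I A l)"

text \<open>
  The distinctness in \<open>P3\<close> is not redundant: without it, one point and no lines
  would be a model.
\<close>

locale projective_plane =
  fixes I :: "'p \<Rightarrow> 'l \<Rightarrow> bool"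
  assumes P1: "A \<noteq> B \<Longrightarrow> \<exists>!l. I A l \<and> I B l"
    and P2: "m \<noteq> n \<Longrightarrow> \<exists>!A. I A m \<and> I A n"
    and P3: "\<exists>A B C D. distinct [A, B, C, D] \<and>
      \<not> collinear I {A, B, C} \<and> \<not> collinear I {A, B, D} \<and>
      \<not> collinear I {A, C, D} \<and> \<not> collinear I {B, C, D}"

text \<open>In a projective plane, these are meaningful only for distinct arguments.\<close>

definition join :: "('p \<Rightarrow> 'l \<Rightarrow> bool) \<Rightarrow> 'p \<Rightarrow> 'p \<Rightarrow> 'l" where
  "join I A B = (THE l. I A l \<and> I B l)"

definition meet :: "('p \<Rightarrow> 'l \<Rightarrow> bool) \<Rightarrow> 'l \<Rightarrow> 'l \<Rightarrow> 'p" where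
  "meet I m n = (THE A. I A m \<and> I A n)"

definition triangle :: "('p \<Rightarrow> 'l \<Rightarrow> bool) \<Rightarrow> 'p \<Rightarrow> 'p \<Rightarrow> 'p \<Rightarrow> bool" where
  "triangle I A B C \<longleftrightarrow> \<not> collinear I {A, B, C}"

text \<open>
  The six inequalities make every join and meet in the two properties below well defined.
  The remaining requirements are automatic: \<open>A\<close> lies on \<open>AA'\<close> but not on \<open>BC\<close>, so
  \<open>BC \<noteq> AA'\<close>; and \<open>P\<close> lies on \<open>B'C'\<close> but \<open>A'\<close> does not, so \<open>A' \<noteq> P\<close>.
\<close>

definition admissible ::
  "('p \<Rightarrow> 'l \<Rightarrow> bool) \<Rightarrow> 'p \<Rightarrow> 'p \<Rightarrow> 'p \<Rightarrow> 'p \<Rightarrow> 'p \<Rightarrow> 'p \<Rightarrow> bool" where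
  "admissible I A B C A' B' C' \<longleftrightarrow>
    triangle I A B C \<and> triangle I A' B' C' \<and>
    A \<noteq> A' \<and> B \<noteq> B' \<and> C \<noteq> C' \<and>
    join I B C \<noteq> join I B' C' \<and> join I A C \<noteq> join I A' C' \<and> join I A B \<noteq> join I A' B'"

definition bricard :: "('p \<Rightarrow> 'l \<Rightarrow> bool) \<Rightarrow> bool" where
  "bricard I \<longleftrightarrow> (\<forall>A B C A' B' C'. admissible I A B C A' B' C' \<longrightarrow>
    (let P = meet I (join I B C) (join I B' C');
         Q = meet I (join I A C) (join I A' C');
         R = meet I (join I A B) (join I A' B');
         D = meet I (join I B C) (join I A A');
         E = meet I (join I A C) (join I B B');
         F = meet I (join I A B) (join I C C')
     in concurrent I {join I A' P, join I B' Q, join I C' R} \<longrightarrow> collinear I {D, E, F}))"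

definition converse_bricard :: "('p \<Rightarrow> 'l \<Rightarrow> bool) \<Rightarrow> bool" where
  "converse_bricard I \<longleftrightarrow> (\<forall>A B C A' B' C'. admissible I A B C A' B' C' \<longrightarrow>
    (let P = meet I (join I B C) (join I B' C');
         Q = meet I (join I A C) (join I A' C');
         R = meet I (join I A B) (join I A' B');
         D = meet I (join I B C) (join I A A');
         E = meet I (join I A C) (join I B B');
         F = meet I (join I A B) (join I C C')
     in collinear I {D, E, F} \<longrightarrow> concurrent I {join I A' P, join I B' Q, join I C' R}))"

definition dual_plane :: "('p \<Rightarrow> 'l \<Rightarrow> bool) \<Rightarrow> 'l \<Rightarrow> 'p \<Rightarrow> bool" where
  "dual_plane I = (\<lambda>l A. I A l)"

definition dual_property ::
  "(('l \<Rightarrow> 'p \<Rightarrow> bool) \<Rightarrow> bool) \<Rightarrow> ('p \<Rightarrow> 'l \<Rightarrow> bool) \<Rightarrow> bool" where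
  "dual_property \<Phi> I \<longleftrightarrow> \<Phi> (dual_plane I)"

lemma join_dual_plane: "join (dual_plane I) = meet I"
  by (simp add: fun_eq_iff join_def meet_def dual_plane_def)

lemma meet_dual_plane: "meet (dual_plane I) = join I"
  by (simp add: fun_eq_iff join_def meet_def dual_plane_def)

lemma collinear_dual_plane: "collinear (dual_plane I) = concurrent I"
  by (simp add: fun_eq_iff collinear_def concurrent_def dual_plane_def)

lemma concurrent_dual_plane: "concurrent (dual_plane I) = collinear I"
  by (simp add: fun_eq_iff collinear_def concurrent_def dual_plane_def)

text \<open>The dual of the Bricard property, written out in terms of the plane itself.\<close>

lemma dual_bricard_explicit:
  "dual_property bricard I \<longleftrightarrow>
    (\<forall>a b c a' b' c'.
      \<not> concurrent I {a, b, c} \<and> \<not> concurrent I {a', b', c'} \<and>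
      a \<noteq> a' \<and> b \<noteq> b' \<and> c \<noteq> c' \<and>
      meet I b c \<noteq> meet I b' c' \<and> meet I a c \<noteq> meet I a' c' \<and> meet I a b \<noteq> meet I a' b' \<longrightarrow>
      (let p = join I (meet I b c) (meet I b' c');
           q = join I (meet I a c) (meet I a' c');
           r = join I (meet I a b) (meet I a' b');
           d = join I (meet I b c) (meet I a a');
           e = join I (meet I a c) (meet I b b');
           f = join I (meet I a b) (meet I c c')
       in collinear I {meet I a' p, meet I b' q, meet I c' r} \<longrightarrow> concurrent I {d, e, f}))"
  by (simp add: dual_property_def bricard_def admissible_def triangle_def join_dual_plane
      meet_dual_plane collinear_dual_plane concurrent_dual_plane)

end

theory Submission imports Defs begin

text \<open>
  Read a triple of lines as the sides of a triangle. Dualising the Bricard property then yields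
  the converse Bricard property with the two triangles interchanged: the points \<open>a' \<inter> p\<close>,
  \<open>b' \<inter> q\<close>, \<open>c' \<inter> r\<close> are the points \<open>D\<close>, \<open>E\<close>, \<open>F\<close>, and the lines \<open>d\<close>, \<open>e\<close>, \<open>f\<close> are the
  lines \<open>A'P\<close>, \<open>B'Q\<close>, \<open>C'R\<close>, of the pair whose first triangle has sides \<open>a'\<close>, \<open>b'\<close>, \<open>c'\<close>.
  Passing from vertices to sides is inverse to its own dual, and the non-degeneracy conditions
  correspond, so the two properties quantify over the same configurations.
\<close>

lemma join_commute: "join I A B = join I B A"
  by (simp add: join_def conj_commute)

lemma meet_commute: "meet I m n = meet I n m"
  by (simp add: meet_def conj_commute)

lemma dual_plane_dual_plane [simp]: "dual_plane (dual_plane I) = I"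
  by (simp add: dual_plane_def)

context projective_plane
begin

lemma point_unique:
  "\<lbrakk>m \<noteq> n; I A m; I A n; I B m; I B n\<rbrakk> \<Longrightarrow> A = B"
  using P2 by blast

lemma join_incident: "A \<noteq> B \<Longrightarrow> I A (join I A B) \<and> I B (join I A B)"
  unfolding join_def using P1[of A B] by (rule theI')

lemma meet_eq: "\<lbrakk>m \<noteq> n; I A m; I A n\<rbrakk> \<Longrightarrow> meet I m n = A"
  unfolding meet_def using point_unique by blast

text \<open>The first two axioms trade places. For the third, the sides AB, BC, CD, DA of a
  quadrangle, taken in cyclic order, are four lines no three of which concur.\<close>

lemma dual_projective_plane: "projective_plane (dual_plane I)"
proof
  show "\<exists>!X. dual_plane I m X \<and> dual_plane I n X" if "m \<noteq> n" for m n
    using P2[OF that] by (simp add: dual_plane_def)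
  show "\<exists>!m. dual_plane I m A \<and> dual_plane I m B" if "A \<noteq> B" for A B
    using P1[OF that] by (simp add: dual_plane_def)
  obtain A B C D where dist: "distinct [A, B, C, D]"
    and nc: "\<not> collinear I {A, B, C}" "\<not> collinear I {A, B, D}"
      "\<not> collinear I {A, C, D}" "\<not> collinear I {B, C, D}"
    using P3 by blast
  define k l m n where defs: "k = join I A B" "l = join I B C" "m = join I C D" "n = join I D A"
  have inc: "I A k" "I B k" "I B l" "I C l" "I C m" "I D m" "I D n" "I A n"
    using dist join_incident by (auto simp: defs)
  have off: "\<not> I C k" "\<not> I D k" "\<not> I A l" "\<not> I D l" "\<not> I A m" "\<not> I B m" "\<not> I B n" "\<not> I C n"
    using nc inc by (auto simp: collinear_def)
  have neq: "k \<noteq> l" "k \<noteq> m" "k \<noteq> n" "l \<noteq> m" "l \<noteq> n" "m \<noteq> n"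
    using inc off by auto
  \<comment> \<open>Each triple contains \<open>k\<close> and \<open>l\<close>, which meet only in
    \<open>B\<close>, or \<open>m\<close> and \<open>n\<close>, which meet only in \<open>D\<close>;
    its third line misses that point.\<close>
  have "\<not> concurrent I {k, l, m}" "\<not> concurrent I {k, l, n}"
    "\<not> concurrent I {k, m, n}" "\<not> concurrent I {l, m, n}"
    using point_unique[OF neq(1)] point_unique[OF neq(6)] inc off
    by (auto simp: concurrent_def)
  then show "\<exists>k l m n. distinct [k, l, m, n] \<and>
      \<not> collinear (dual_plane I) {k, l, m} \<and> \<not> collinear (dual_plane I) {k, l, n} \<and>
      \<not> collinear (dual_plane I) {k, m, n} \<and> \<not> collinear (dual_plane I) {l, m, n}"
    unfolding collinear_dual_plane using neq
    by (intro exI[of _ k] exI[of _ l] exI[of _ m] exI[of _ n]) simp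
qed

text \<open>Including \<open>A = B\<close> makes any triple with a repeated point collinear, so the
  vertices of a triangle are distinct.\<close>

lemma ex_line_through_two: "\<exists>l. I A l \<and> I B l"
proof (cases "A = B")
  case True
  obtain X where "X \<noteq> A" using P3 by (metis distinct_length_2_or_more)
  then show ?thesis using P1[of X A] True by blast
next
  case False
  then show ?thesis using P1 by blast
qed

lemma triangle_distinct:
  assumes "triangle I A B C"
  shows "A \<noteq> B" "A \<noteq> C" "B \<noteq> C"
  using assms ex_line_through_two by (auto simp: triangle_def collinear_def)

text \<open>Each vertex lies on two sides but, by noncollinearity, not on the third. Hence the sides
  are distinct, and two of them meet only in their shared vertex.\<close>

lemma triangle_sides:
  assumes "triangle I A B C"
  shows "\<not> concurrent I {join I B C, join I A C, join I A B}"
    and "meet I (join I A C) (join I A B) = A"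
    and "meet I (join I B C) (join I A B) = B"
    and "meet I (join I B C) (join I A C) = C"
proof -
  let ?a = "join I B C" and ?b = "join I A C" and ?c = "join I A B"
  have inc: "I B ?a" "I C ?a" "I A ?b" "I C ?b" "I A ?c" "I B ?c"
    using triangle_distinct[OF assms] join_incident by auto
  have off: "\<not> I A ?a" "\<not> I B ?b" "\<not> I C ?c"
    using assms inc by (auto simp: triangle_def collinear_def)
  have neq: "?a \<noteq> ?b" "?a \<noteq> ?c" "?b \<noteq> ?c"
    using inc off by metis+
  show "meet I ?b ?c = A" "meet I ?a ?c = B" "meet I ?a ?b = C"
    using neq inc by (auto intro: meet_eq)
  show "\<not> concurrent I {?a, ?b, ?c}"
    using point_unique[OF neq(3)] inc off by (auto simp: concurrent_def)
qed

text \<open>The conditions trade places: distinct corresponding sides become distinct dual points,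
  while \<open>A \<noteq> A'\<close> and its analogues become distinctness of the dual joins, since
  two sides meet in the vertex they share.\<close>

lemma admissible_sides:
  assumes "admissible I A B C A' B' C'"
  shows "admissible (dual_plane I) (join I B' C') (join I A' C') (join I A' B')
    (join I B C) (join I A C) (join I A B)"
  using assms triangle_sides[of A B C] triangle_sides[of A' B' C']
  by (auto simp: admissible_def triangle_def join_dual_plane collinear_dual_plane)

lemma dual_bricard_imp_converse_bricard:
  assumes "bricard (dual_plane I)"
  shows "converse_bricard I"
  unfolding converse_bricard_def
proof (intro allI impI)
  fix A B C A' B' C'
  assume adm: "admissible I A B C A' B' C'"
  then have "triangle I A B C" "triangle I A' B' C'"
    by (auto simp: admissible_def)
  note sides = triangle_sides(2-4)[OF this(1)] triangle_sides(2-4)[OF this(2)]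
  show "let P = meet I (join I B C) (join I B' C');
         Q = meet I (join I A C) (join I A' C');
         R = meet I (join I A B) (join I A' B');
         D = meet I (join I B C) (join I A A');
         E = meet I (join I A C) (join I B B');
         F = meet I (join I A B) (join I C C')
     in collinear I {D, E, F} \<longrightarrow> concurrent I {join I A' P, join I B' Q, join I C' R}"
    \<comment> \<open>In this instance the dual join of the second and third lines is
      \<open>A'\<close> for the first triple and \<open>A\<close> for the second. So
      \<open>p\<close> is the line AA', which meets BC in \<open>D\<close>, and \<open>d\<close> is
      A'P; the other two indices are alike.\<close>
    using assms[unfolded bricard_def, rule_format, OF admissible_sides[OF adm]]
    by (simp add: Let_def join_dual_plane meet_dual_plane collinear_dual_plane
        concurrent_dual_plane sides
        join_commute[of I A' A] join_commute[of I B' B] join_commute[of I C' C]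
        meet_commute[of I "join I B' C'" "join I B C"]
        meet_commute[of I "join I A' C'" "join I A C"]
        meet_commute[of I "join I A' B'" "join I A B"])
qed

lemma converse_bricard_imp_dual_bricard:
  assumes "converse_bricard I"
  shows "bricard (dual_plane I)"
  unfolding bricard_def
proof (intro allI impI)
  interpret dual: projective_plane "dual_plane I"
    by (rule dual_projective_plane)
  fix a b c a' b' c'
  assume adm: "admissible (dual_plane I) a b c a' b' c'"
  then have "triangle (dual_plane I) a b c" "triangle (dual_plane I) a' b' c'"
    by (auto simp: admissible_def)
  \<comment> \<open>Read in the dual plane, this recovers each line as the join of its two
    intersection points with the others of its triple.\<close>
  note sides = dual.triangle_sides(2-4)[OF this(1), unfolded join_dual_plane meet_dual_plane]
    dual.triangle_sides(2-4)[OF this(2), unfolded join_dual_plane meet_dual_plane]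
  \<comment> \<open>The dual of the dual is \<open>I\<close> itself, so the lemma used in the dual
    plane leads back to \<open>I\<close>.\<close>
  have "admissible I (meet I b' c') (meet I a' c') (meet I a' b')
      (meet I b c) (meet I a c) (meet I a b)"
    using dual.admissible_sides[OF adm] by (simp add: join_dual_plane)
  note conv = assms[unfolded converse_bricard_def, rule_format, OF this]
  show "let P = meet (dual_plane I) (join (dual_plane I) b c) (join (dual_plane I) b' c');
         Q = meet (dual_plane I) (join (dual_plane I) a c) (join (dual_plane I) a' c');
         R = meet (dual_plane I) (join (dual_plane I) a b) (join (dual_plane I) a' b');
         D = meet (dual_plane I) (join (dual_plane I) b c) (join (dual_plane I) a a');
         E = meet (dual_plane I) (join (dual_plane I) a c) (join (dual_plane I) b b');
         F = meet (dual_plane I) (join (dual_plane I) a b) (join (dual_plane I) c c')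
     in concurrent (dual_plane I)
          {join (dual_plane I) a' P, join (dual_plane I) b' Q, join (dual_plane I) c' R} \<longrightarrow>
        collinear (dual_plane I) {D, E, F}"
    using conv
    by (simp add: Let_def join_dual_plane meet_dual_plane collinear_dual_plane
        concurrent_dual_plane sides
        meet_commute[of I a' a] meet_commute[of I b' b] meet_commute[of I c' c]
        join_commute[of I "meet I b' c'" "meet I b c"]
        join_commute[of I "meet I a' c'" "meet I a c"]
        join_commute[of I "meet I a' b'" "meet I a b"])
qed

end

theorem theorem3p1:
  fixes I :: "'p \<Rightarrow> 'l \<Rightarrow> bool"
  assumes "projective_plane I"
  shows "dual_property bricard I \<longleftrightarrow> converse_bricard I"
  using projective_plane.dual_bricard_imp_converse_bricard[OF assms]
    projective_plane.converse_bricard_imp_dual_bricard[OF assms]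
  unfolding dual_property_def by blast

end
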